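(* Let $n_0\ge 1$ and $f\in\operatorname{ReLU}^{\mathbb{Q}}_{\mathbf{0}}(n_0,1)$, and let $f_\theta^{\mathrm{red}}:\mathbb{R}^{n_0}\xrightarrow{\varsigma\circ L_1}\mathbb{R}^{n_1}\xrightarrow{L_2}\mathbb{R}$ be the reduced ReLU representation of $f$. Let $H^{(1)}_1,\dots,H^{(1)}_{n_1}\subset\mathbb{R}^{n_0}$ be the hyperplanes defined by the rows of $L_1$, and assume that the ReLU fan $\Sigma_{f_\theta^{\mathrm{red}}}$ is a fan. Then for every $i\in\{1,\dots,n_1\}$ and any two walls $\tau_1,\tau_2$ of $\Sigma_{f_\theta^{\mathrm{red}}}$ with $\tau_1,\tau_2\subseteq H^{(1)}_i$, $$D_f\cdot V(\tau_1)=D_f\cdot V(\tau_2),$$ where $D_f$ is the ReLU Cartier divisor of $f$ supported on $\Sigma_{f_\theta^{\mathrm{red}}}$.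
   Context: $\varsigma$ applies $x\mapsto\max\{0,x\}$ to each coordinate. $\operatorname{ReLU}^{\mathbb{Q}}_{\mathbf{0}}(n_0,1)$ is the set of functions $\mathbb{R}^{n_0}\to\mathbb{R}$ of the form $L_2\circ\varsigma\circ L_1$, where $L_1:\mathbb{R}^{n_0}\to\mathbb{R}^{n_1}$ and $L_2:\mathbb{R}^{n_1}\to\mathbb{R}$ are linear maps with rational matrix entries, for some $n_1$. Reduced ReLU representation. A representation $f=L_2\circ\varsigma\circ L_1$ with rational matrices $L_1=(a_{ij})$, $L_2=(b_{1i})$ is reduced if: $L_1$ has no zero row; all $a_{ij}$ are integers; $\gcd(a_{i1},\dots,a_{in_0})=1$ for each row $i$; and no two distinct rows of $L_1$ are positive multiples of each other. (Rows that are negatives of each other are allowed.) ReLU fan. $H^{(1)}_i=\{x\in\mathbb{R}^{n_0}:a_{i1}x_1+\dots+a_{in_0}x_{n_0}=0\}$, and $\Sigma_{f_\theta^{\mathrm{red}}}$ is the collection of all faces of the closed chambers of the arrangement $\{H^{(1)}_1,\dots,H^{(1)}_{n_1}\}$; it is a finite collection of rational polyhedral cones covering $\mathbb{R}^{n_0}$. Standing assumption: it is a fan, i.e. all its cones are strongly convex. $N=\mathbb{Z}^{n_0}$, $N_{\mathbb{R}}=\mathbb{R}^{n_0}$, $M=\mathbb{Z}^{n_0}$ is the dual lattice, and $\langle\cdot,\cdot\rangle$ is the dot product. A wall is a cone of dimension $n_0-1$; every wall $\tau$ is $\sigma\cap\sigma'$ for exactly two maximal cones $\sigma,\sigma'$.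 $V(\tau)\cong\mathbb{P}^1$ is the corresponding complete torus-invariant curve in the toric variety of the fan. ReLU Cartier divisor. $f$ is linear on each cone: on each maximal cone $\sigma$, $f(u)=\langle m_\sigma,u\rangle$ with $m_\sigma\in M\otimes\mathbb{Q}$. $D_f$ is the torus-invariant $\mathbb{Q}$-Cartier divisor on the toric variety of the fan with support function $f$, i.e. with Cartier data $\{m_\sigma\}$ ($D_f=-\sum_\rho f(u_\rho)D_\rho$, where $u_\rho$ is the minimal generator of the ray $\rho$ and $D_\rho$ the corresponding prime divisor). Intersection number. For a wall $\tau=\sigma\cap\sigma'$, let $N_\tau=\operatorname{Span}(\tau)\cap N$, and choose $u\in\sigma'\cap N$ whose image in $N/N_\tau\cong\mathbb{Z}$ is the minimal generator of the ray that is the image of $\sigma'$. Then $D_f\cdot V(\tau)=\langle m_\sigma-m_{\sigma'},u\rangle\in\mathbb{Q}$ (independent of the choices). *)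

theory Defs
  imports "HOL-Analysis.Analysis"
begin

text \<open>
  The input space is \<open>real ^ 'n\<close> with \<open>n\<^sub>0 = CARD('n)\<close>. The width \<open>n\<^sub>1\<close> of the hidden layer is a natural
  number \<open>n\<close>; vectors of length \<open>n\<close> are functions on \<open>nat\<close>, read at the indices \<open>i < n\<close> and
  set to \<open>0\<close> beyond. The first matrix is given by its rows \<open>A i\<close>, the second one is the single
  row \<open>b\<close>.
\<close>

definition input_map :: "nat \<Rightarrow> (nat \<Rightarrow> real ^ 'n) \<Rightarrow> real ^ 'n \<Rightarrow> (nat \<Rightarrow> real)" where
  "input_map n A x = (\<lambda>i. if i < n then A i \<bullet> x else 0)"

definition relu :: "(nat \<Rightarrow> real) \<Rightarrow> (nat \<Rightarrow> real)" where
  "relu y = (\<lambda>i. max 0 (y i))"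

definition output_map :: "nat \<Rightarrow> (nat \<Rightarrow> real) \<Rightarrow> (nat \<Rightarrow> real) \<Rightarrow> real" where
  "output_map n b y = (\<Sum>i<n. b i * y i)"

definition rational_relu_rep ::
    "nat \<Rightarrow> (nat \<Rightarrow> real ^ 'n) \<Rightarrow> (nat \<Rightarrow> real) \<Rightarrow> (real ^ 'n \<Rightarrow> real) \<Rightarrow> bool" where
  "rational_relu_rep n A b f \<longleftrightarrow>
     (\<forall>i<n. \<forall>j. A i $ j \<in> \<rat>) \<and> (\<forall>i<n. b i \<in> \<rat>) \<and>
     f = output_map n b \<circ> relu \<circ> input_map n A"

definition ReLU_Q :: "(real ^ 'n \<Rightarrow> real) set" where
  "ReLU_Q = {f. \<exists>n A b. rational_relu_rep n A b f}"

definition reduced_relu_rep ::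
    "nat \<Rightarrow> (nat \<Rightarrow> real ^ 'n) \<Rightarrow> (nat \<Rightarrow> real) \<Rightarrow> (real ^ 'n \<Rightarrow> real) \<Rightarrow> bool" where
  "reduced_relu_rep n A b f \<longleftrightarrow>
     rational_relu_rep n A b f \<and>
     (\<forall>i<n. A i \<noteq> 0) \<and>
     (\<forall>i<n. \<forall>j. A i $ j \<in> \<int>) \<and>
     (\<forall>i<n. Gcd (range (\<lambda>j. \<lfloor>A i $ j\<rfloor>)) = 1) \<and>
     (\<forall>i<n. \<forall>k<n. i \<noteq> k \<longrightarrow> \<not> (\<exists>c>0. A i = c *\<^sub>R A k))"

definition hyperplane :: "real ^ 'n \<Rightarrow> (real ^ 'n) set" where
  "hyperplane a = {x. a \<bullet> x = 0}"

definition closed_chambers :: "nat \<Rightarrow> (nat \<Rightarrow> real ^ 'n) \<Rightarrow> (real ^ 'n) set set" where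
  "closed_chambers n A = closure ` components (UNIV - (\<Union>i<n. hyperplane (A i)))"

text \<open>\<open>{} face_of C\<close> holds for every \<open>C\<close>, whereas the faces of a cone are nonempty by convention.\<close>

definition relu_fan :: "nat \<Rightarrow> (nat \<Rightarrow> real ^ 'n) \<Rightarrow> (real ^ 'n) set set" where
  "relu_fan n A = {F. F \<noteq> {} \<and> (\<exists>C \<in> closed_chambers n A. F face_of C)}"

definition strongly_convex :: "(real ^ 'n) set \<Rightarrow> bool" where
  "strongly_convex \<sigma> \<longleftrightarrow> \<sigma> \<inter> uminus ` \<sigma> = {0}"

definition maximal_cones :: "(real ^ 'n) set set \<Rightarrow> (real ^ 'n) set set" where
  "maximal_cones \<Sigma> = {\<sigma> \<in> \<Sigma>. \<forall>\<kappa>\<in>\<Sigma>. \<sigma> \<subseteq> \<kappa> \<longrightarrow> \<kappa> = \<sigma>}"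

definition walls :: "(real ^ 'n) set set \<Rightarrow> (real ^ 'n) set set" where
  "walls \<Sigma> = {\<tau> \<in> \<Sigma>. dim \<tau> + 1 = CARD('n)}"

text \<open>
  A torus-invariant \<open>\<rat>\<close>-Cartier divisor on the toric variety of a complete fan is encoded by its
  Cartier data, a vector \<open>m\<^sub>\<sigma>\<close> with rational entries for each maximal cone \<open>\<sigma>\<close>. For the divisor
  with support function \<open>f\<close>, \<open>m\<^sub>\<sigma>\<close> is the linear form that \<open>f\<close> restricts to on \<open>\<sigma>\<close>, which is
  unique because \<open>\<sigma>\<close> is full-dimensional. The sign convention is the one for which the coefficient
  at a ray with minimal generator \<open>u\<close> is \<open>- f u\<close>.
\<close>

definition support_divisor ::
    "(real ^ 'n) set set \<Rightarrow> (real ^ 'n \<Rightarrow> real) \<Rightarrow> (real ^ 'n) set \<Rightarrow> real ^ 'n" where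
  "support_divisor \<Sigma> f =
     (\<lambda>\<sigma> \<in> maximal_cones \<Sigma>. THE m. (\<forall>j. m $ j \<in> \<rat>) \<and> (\<forall>u\<in>\<sigma>. f u = m \<bullet> u))"

definition lattice :: "(real ^ 'n) set" where
  "lattice = {x. \<forall>j. x $ j \<in> \<int>}"

definition wall_lattice :: "(real ^ 'n) set \<Rightarrow> (real ^ 'n) set" where
  "wall_lattice \<tau> = span \<tau> \<inter> lattice"

text \<open>
  The image of \<open>u\<close> in \<open>N / N\<^sub>\<tau>\<close> is the minimal generator of the image ray of \<open>\<sigma>\<close>, i.e. it generates
  the semigroup of all lattice points of the image ray. A class \<open>v + N\<^sub>\<tau>\<close> lies on the image of \<open>\<sigma>\<close>
  iff \<open>v = s + t\<close> for some \<open>s \<in> \<sigma>\<close> and \<open>t \<in> span \<tau>\<close>; two lattice points agree in \<open>N / N\<^sub>\<tau>\<close> iff their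
  difference is in \<open>N\<^sub>\<tau>\<close>.
\<close>

definition lifts_minimal_generator :: "(real ^ 'n) set \<Rightarrow> (real ^ 'n) set \<Rightarrow> real ^ 'n \<Rightarrow> bool" where
  "lifts_minimal_generator \<tau> \<sigma> u \<longleftrightarrow>
     u \<in> \<sigma> \<inter> lattice \<and>
     (\<forall>v\<in>lattice. (\<exists>s\<in>\<sigma>. \<exists>t\<in>span \<tau>. v = s + t) \<longrightarrow>
        (\<exists>k::nat. v - of_nat k *\<^sub>R u \<in> wall_lattice \<tau>))"

text \<open>
  The number \<open>D \<cdot> V(\<tau>)\<close> for a divisor given by Cartier data \<open>D\<close>. Here \<open>\<sigma>, \<sigma>'\<close> are the two maximal
  cones meeting in \<open>\<tau>\<close>; for Cartier data the value depends neither on their order nor on \<open>u\<close>.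
\<close>

definition intersection_number ::
    "(real ^ 'n) set set \<Rightarrow> ((real ^ 'n) set \<Rightarrow> real ^ 'n) \<Rightarrow> (real ^ 'n) set \<Rightarrow> real" where
  "intersection_number \<Sigma> D \<tau> =
     (THE q. \<exists>\<sigma> \<sigma>' u. \<sigma> \<in> maximal_cones \<Sigma> \<and> \<sigma>' \<in> maximal_cones \<Sigma> \<and> \<sigma> \<noteq> \<sigma>' \<and> \<tau> = \<sigma> \<inter> \<sigma>' \<and>
        lifts_minimal_generator \<tau> \<sigma>' u \<and> q = (D \<sigma> - D \<sigma>') \<bullet> u)"

end

theory Submission
  imports Defs
begin

text \<open>
  Crossing a wall in \<open>H\<^sub>i\<close> changes the sign of \<open>A k \<bullet> _\<close> exactly for the rows with
  \<open>H\<^sub>k = H\<^sub>i\<close>. As all rows are primitive integer vectors, these are the rows \<open>A k = \<plusminus> A i\<close>, so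
  the linear form of \<open>f\<close> jumps by \<open>\<plusminus> (\<Sum>b k) A i\<close>, where \<open>k\<close> runs over these rows. Since \<open>A i\<close> is
  primitive, it identifies \<open>N / N\<^sub>\<tau>\<close> with the integers and takes the value \<open>\<plusminus> 1\<close> on a lift of the
  minimal generator. Hence the intersection number is \<open>- (\<Sum>b k)\<close> for every wall in \<open>H\<^sub>i\<close>.
\<close>

section \<open>Perturbation estimate, integer functionals and lattice points\<close>

text \<open>The sum of all ratios \<open>\<bar>h k\<bar> / g k\<close> bounds each of them, so one
  \<open>M\<close> serves every \<open>k\<close>. It is used to move far along a direction
  satisfying strict sign conditions, where a fixed perturbation cannot change a sign.\<close>

lemma large_multiple_dominates:
  fixes g h :: "'a \<Rightarrow> real"
  assumes "finite K" and "\<And>k. k \<in> K \<Longrightarrow> 0 < g k"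
  obtains M :: nat where "\<And>k. k \<in> K \<Longrightarrow> 0 < real M * g k + h k"
proof -
  obtain M :: nat where M: "(\<Sum>k\<in>K. \<bar>h k\<bar> / g k) < real M"
    using reals_Archimedean2 by blast
  have "0 < real M * g k + h k" if k: "k \<in> K" for k
  proof -
    have "\<bar>h k\<bar> / g k \<le> (\<Sum>k\<in>K. \<bar>h k\<bar> / g k)"
      using assms k by (intro member_le_sum) (auto simp: less_imp_le)
    with M have "\<bar>h k\<bar> / g k < real M" by linarith
    then have "\<bar>h k\<bar> < real M * g k"
      using assms(2)[OF k] by (simp add: pos_divide_less_eq)
    then show ?thesis by linarith
  qed
  then show thesis using that by blast
qed

lemma bezout_Gcd_finite:
  fixes c :: "'a \<Rightarrow> int"
  assumes "finite S"
  shows "\<exists>g. (\<Sum>j\<in>S. c j * g j) = Gcd (c ` S)"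
  using assms
proof (induction S)
  case empty
  then show ?case by simp
next
  case (insert a S)
  then obtain g where g: "(\<Sum>j\<in>S. c j * g j) = Gcd (c ` S)" by blast
  obtain p q where pq: "p * c a + q * Gcd (c ` S) = gcd (c a) (Gcd (c ` S))"
    using bezout_int by blast
  have "(\<Sum>j\<in>insert a S. c j * (if j = a then p else q * g j))
      = c a * p + (\<Sum>j\<in>S. c j * (if j = a then p else q * g j))"
    using insert.hyps by simp
  also have "(\<Sum>j\<in>S. c j * (if j = a then p else q * g j)) = (\<Sum>j\<in>S. q * (c j * g j))"
    using insert.hyps by (intro sum.cong) auto
  also have "\<dots> = q * Gcd (c ` S)"
    by (simp add: g flip: sum_distrib_left)
  finally show ?case
    using pq by (intro exI[of _ "\<lambda>j. if j = a then p else q * g j"]) (simp add: mult.commute)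
qed

lemma lattice_add: "x \<in> lattice \<Longrightarrow> y \<in> lattice \<Longrightarrow> x + y \<in> lattice"
  and lattice_diff: "x \<in> lattice \<Longrightarrow> y \<in> lattice \<Longrightarrow> x - y \<in> lattice"
  and lattice_scaleR: "c \<in> \<int> \<Longrightarrow> x \<in> lattice \<Longrightarrow> c *\<^sub>R x \<in> lattice"
  and lattice_inner: "x \<in> lattice \<Longrightarrow> y \<in> lattice \<Longrightarrow> x \<bullet> y \<in> \<int>"
  by (auto simp: lattice_def inner_vec_def)

text \<open>The Bezout coefficients of the entries of \<open>a\<close> are the coordinates of
  \<open>v\<close>. A primitive row thus maps the lattice onto the integers.\<close>

lemma lattice_unimodular_functional:
  fixes a :: "real ^ 'n"
  assumes a: "a \<in> lattice" and gcd: "Gcd (range (\<lambda>j. \<lfloor>a $ j\<rfloor>)) = 1"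
  obtains v where "v \<in> lattice" and "a \<bullet> v = 1"
proof -
  obtain g where g: "(\<Sum>j\<in>UNIV. \<lfloor>a $ j\<rfloor> * g j) = (1 :: int)"
    using bezout_Gcd_finite[of "UNIV :: 'n set" "\<lambda>j. \<lfloor>a $ j\<rfloor>"] gcd by auto
  have fl: "real_of_int \<lfloor>a $ j\<rfloor> = a $ j" for j
    using a by (simp add: lattice_def)
  show thesis
  proof (rule that)
    show "(\<chi> j. real_of_int (g j)) \<in> lattice" by (simp add: lattice_def)
    have "a \<bullet> (\<chi> j. real_of_int (g j)) = (\<Sum>j\<in>UNIV. real_of_int (\<lfloor>a $ j\<rfloor> * g j))"
      by (simp add: inner_vec_def fl)
    also have "\<dots> = 1" using g by (metis of_int_1 of_int_sum)
    finally show "a \<bullet> (\<chi> j. real_of_int (g j)) = 1" .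
  qed
qed

text \<open>The kernel inclusion makes \<open>c\<close> the multiple
  \<open>(c \<bullet> v) *\<^sub>R a\<close>. Evaluating at \<open>w\<close> shows that the integers
  \<open>c \<bullet> v\<close> and \<open>a \<bullet> w\<close> have product 1, so the factor is a
  unit.\<close>

lemma unimodular_functionals_same_kernel:
  fixes a c :: "real ^ 'n"
  assumes "a \<in> lattice" "v \<in> lattice" "a \<bullet> v = 1"
    and "c \<in> lattice" "w \<in> lattice" "c \<bullet> w = 1"
    and ker: "\<And>x. a \<bullet> x = 0 \<Longrightarrow> c \<bullet> x = 0"
  shows "c = a \<or> c = - a"
proof -
  have c: "c \<bullet> x = (c \<bullet> v) * (a \<bullet> x)" for x
    using ker[of "x - (a \<bullet> x) *\<^sub>R v"] assms(3) by (simp add: inner_diff_right mult.commute)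
  have "(c \<bullet> v) * (a \<bullet> w) = 1" using c[of w] assms(6) by simp
  moreover obtain p q where pq: "c \<bullet> v = of_int p" "a \<bullet> w = of_int q"
    using lattice_inner assms(1,2,4,5) by (metis Ints_cases)
  ultimately have "p * q = 1" by (metis of_int_1 of_int_eq_iff of_int_mult)
  then have "p = 1 \<or> p = - 1" using zmult_eq_1_iff by blast
  moreover have "c = (c \<bullet> v) *\<^sub>R a"
    by (rule inner_commute[THEN trans, THEN vector_eq_rdot[THEN iffD1, OF allI]])
       (metis c inner_commute inner_scaleR_left)
  ultimately show ?thesis using pq by auto
qed

text \<open>Dyadic points are dense, and multiplying one of them by its denominator
  \<open>2^k\<close> gives a lattice point on the same ray.\<close>

lemma open_contains_scaled_lattice_point:
  fixes S :: "(real ^ 'n) set"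
  assumes "open S" "S \<noteq> {}"
  obtains w and c :: real where "w \<in> S" and "0 < c" and "c *\<^sub>R w \<in> lattice"
proof -
  let ?D = "\<Union>k. \<Union>f \<in> Basis \<rightarrow> \<int>. {\<Sum>i :: real ^ 'n \<in> Basis. (f i / 2^k) *\<^sub>R i}"
  have "S \<inter> closure ?D \<noteq> {}" using closure_dyadic_rationals assms(2) by blast
  then have "S \<inter> ?D \<noteq> {}" using assms(1) open_Int_closure_eq_empty by blast
  then obtain k :: nat and f :: "real ^ 'n \<Rightarrow> real"
    where f: "f \<in> Basis \<rightarrow> \<int>" and inS: "(\<Sum>i\<in>Basis. (f i / 2^k) *\<^sub>R i) \<in> S"
    by blast
  have "2^k *\<^sub>R (\<Sum>i\<in>Basis. (f i / 2^k) *\<^sub>R i) = (\<Sum>i\<in>Basis. f i *\<^sub>R i)"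
    by (simp add: scaleR_right.sum)
  moreover have "(\<Sum>i\<in>Basis. f i *\<^sub>R i) $ j \<in> \<int>" for j
    using f by (auto simp: Basis_vec_def axis_def intro!: Ints_sum)
  ultimately have "2^k *\<^sub>R (\<Sum>i\<in>Basis. (f i / 2^k) *\<^sub>R i) \<in> lattice"
    by (simp add: lattice_def)
  then show thesis by (intro that[OF inS, of "2^k"]) simp_all
qed

section \<open>Closed chambers described by sign conditions\<close>

text \<open>The product says that \<open>A k \<bullet> y\<close> has weakly the sign of
  \<open>A k \<bullet> x\<close>. If \<open>A k \<bullet> x = 0\<close>, the condition is void;
  closed chambers of the arrangement arise from base points on no hyperplane.\<close>

definition chamber :: "nat \<Rightarrow> (nat \<Rightarrow> real ^ 'n) \<Rightarrow> real ^ 'n \<Rightarrow> (real ^ 'n) set" where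
  "chamber n A x = {y. \<forall>k<n. 0 \<le> (A k \<bullet> x) * (A k \<bullet> y)}"

definition regular_point :: "nat \<Rightarrow> (nat \<Rightarrow> real ^ 'n) \<Rightarrow> real ^ 'n \<Rightarrow> bool" where
  "regular_point n A x \<longleftrightarrow> (\<forall>k<n. A k \<bullet> x \<noteq> 0)"

text \<open>The sum runs over the neurons active at \<open>x\<close>; for regular \<open>x\<close>
  it is the Cartier datum of the chamber of \<open>x\<close>.\<close>

definition relu_gradient ::
    "nat \<Rightarrow> (nat \<Rightarrow> real ^ 'n) \<Rightarrow> (nat \<Rightarrow> real) \<Rightarrow> real ^ 'n \<Rightarrow> real ^ 'n" where
  "relu_gradient n A b x = (\<Sum>k<n. if 0 < A k \<bullet> x then b k *\<^sub>R A k else 0)"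

lemma convex_chamber: "convex (chamber n A x)"
  by (auto simp: chamber_def convex_def inner_add_right distrib_left mult.left_commute)

lemma closed_chamber: "closed (chamber n A x)"
  unfolding chamber_def by (intro closed_Collect_all closed_Collect_imp closed_Collect_le
      continuous_intros) auto

lemma chamber_scaleR: "y \<in> chamber n A x \<Longrightarrow> 0 \<le> c \<Longrightarrow> c *\<^sub>R y \<in> chamber n A x"
  by (auto simp: chamber_def mult.left_commute)

lemma self_in_chamber: "x \<in> chamber n A x"
  by (simp add: chamber_def)

lemma chamber_cong:
  assumes "\<And>k. k < n \<Longrightarrow> 0 < (A k \<bullet> x) * (A k \<bullet> y)"
  shows "chamber n A x = chamber n A y"
proof -
  have "0 \<le> (A k \<bullet> x) * (A k \<bullet> w) \<longleftrightarrow> 0 \<le> (A k \<bullet> y) * (A k \<bullet> w)" if "k < n" for k w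
    using assms[OF that] by (smt (verit) zero_le_mult_iff zero_less_mult_iff)
  then show ?thesis by (auto simp: chamber_def)
qed

lemma regular_point_square_pos:
  "regular_point n A x \<Longrightarrow> k < n \<Longrightarrow> 0 < (A k \<bullet> x) * (A k \<bullet> x)"
  by (metis not_real_square_gt_zero regular_point_def)

text \<open>The open sign cell is convex, hence connected. A connected set that contains
  \<open>x\<close> and leaves the cell meets one of the hyperplanes by the intermediate value
  theorem.\<close>

lemma connected_component_arrangement_complement:
  fixes A :: "nat \<Rightarrow> real ^ 'n"
  assumes "regular_point n A x"
  shows "connected_component_set (UNIV - (\<Union>k<n. hyperplane (A k))) x
       = {y. \<forall>k<n. 0 < (A k \<bullet> x) * (A k \<bullet> y)}" (is "_ = ?C")
proof (rule connected_component_unique)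
  have *: "(A k \<bullet> x) * (A k \<bullet> x) > 0" if "k < n" for k
    using assms that by (rule regular_point_square_pos)
  then show "x \<in> ?C" by simp
  show "?C \<subseteq> UNIV - (\<Union>k<n. hyperplane (A k))" by (force simp: hyperplane_def)
  have "convex ?C"
    unfolding convex_alt
  proof (safe)
    fix y z and u :: real and k
    assume h: "\<forall>k<n. 0 < (A k \<bullet> x) * (A k \<bullet> y)" "\<forall>k<n. 0 < (A k \<bullet> x) * (A k \<bullet> z)"
      "0 \<le> u" "u \<le> 1" "k < n"
    have "0 < (1 - u) * ((A k \<bullet> x) * (A k \<bullet> y)) + u * ((A k \<bullet> x) * (A k \<bullet> z))"
    proof (cases "u = 0")
      case False
      then have "0 < u * ((A k \<bullet> x) * (A k \<bullet> z))" using h by simp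
      moreover have "0 \<le> (1 - u) * ((A k \<bullet> x) * (A k \<bullet> y))"
        using h by (simp add: less_imp_le)
      ultimately show ?thesis by linarith
    qed (use h in auto)
    then show "0 < (A k \<bullet> x) * (A k \<bullet> ((1 - u) *\<^sub>R y + u *\<^sub>R z))"
      by (simp add: inner_add_right algebra_simps)
  qed
  then show "connected ?C" by (rule convex_connected)
  fix c' assume c': "x \<in> c'" "c' \<subseteq> UNIV - (\<Union>k<n. hyperplane (A k))" "connected c'"
  show "c' \<subseteq> ?C"
  proof (safe, rule ccontr)
    fix y k assume y: "y \<in> c'" "k < n" "\<not> 0 < (A k \<bullet> x) * (A k \<bullet> y)"
    then have "A k \<bullet> x \<le> 0 \<and> 0 \<le> A k \<bullet> y \<or> A k \<bullet> y \<le> 0 \<and> 0 \<le> A k \<bullet> x"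
      by (auto simp: zero_less_mult_iff)
    then obtain z where "z \<in> c'" "A k \<bullet> z = 0"
      using connected_ivt_hyperplane[OF c'(3)] c'(1) y(1) by metis
    with c'(2) y(2) show False by (auto simp: hyperplane_def)
  qed
qed

lemma closed_chambers_eq:
  "closed_chambers n A = chamber n A ` {x. regular_point n A x}"
proof -
  let ?U = "UNIV - (\<Union>k<n. hyperplane (A k))"
  have U: "?U = {x. regular_point n A x}"
    by (auto simp: hyperplane_def regular_point_def)
  have "closure {y. \<forall>k<n. 0 < (A k \<bullet> x) * (A k \<bullet> y)} = chamber n A x" (is "closure ?C = _")
    if x: "regular_point n A x" for x
  proof
    show "closure ?C \<subseteq> chamber n A x"
      by (rule closure_minimal[OF _ closed_chamber]) (auto simp: chamber_def less_imp_le)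
    show "chamber n A x \<subseteq> closure ?C"
    proof
      fix y assume y: "y \<in> chamber n A x"
      \<comment> \<open>Moving \<open>y\<close> slightly in the direction of the regular point
        \<open>x\<close> makes all weak inequalities strict.\<close>
      have "(\<lambda>j. y + inverse (real (Suc j)) *\<^sub>R x) \<longlonglongrightarrow> y + 0 *\<^sub>R x"
        by (intro tendsto_intros LIMSEQ_inverse_real_of_nat)
      moreover have "y + inverse (real (Suc j)) *\<^sub>R x \<in> ?C" for j
      proof safe
        fix k assume k: "k < n"
        have "0 < inverse (real (Suc j)) * ((A k \<bullet> x) * (A k \<bullet> x))"
          using regular_point_square_pos[OF x k] by simp
        moreover have "0 \<le> (A k \<bullet> x) * (A k \<bullet> y)" using y k by (simp add: chamber_def)
        ultimately show "0 < (A k \<bullet> x) * (A k \<bullet> (y + inverse (real (Suc j)) *\<^sub>R x))"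
          by (simp add: inner_add_right distrib_left mult.left_commute)
      qed
      ultimately show "y \<in> closure ?C"
        unfolding closure_sequential by (metis (no_types, lifting) add.right_neutral scaleR_zero_left)
    qed
  qed
  then have "closure (connected_component_set ?U x) = chamber n A x"
    if "regular_point n A x" for x
    using that by (simp only: connected_component_arrangement_complement)
  then show ?thesis
    unfolding closed_chambers_def components_def image_image
    by (intro image_cong) (auto simp only: U mem_Collect_eq)
qed

section \<open>Maximal cones and Cartier data\<close>

text \<open>Every cone of the fan lies in a chamber, so a maximal one is a chamber. Conversely, a
  cone that contains a chamber contains its regular base point, and a chamber is determined by any
  regular point in it.\<close>

lemma maximal_cones_relu_fan:
  "maximal_cones (relu_fan n A) = closed_chambers n A"
proof -
  have fan: "\<sigma> \<in> relu_fan n A" if s: "\<sigma> \<in> closed_chambers n A" for \<sigma>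
  proof -
    obtain x where "\<sigma> = chamber n A x" using s by (auto simp: closed_chambers_eq)
    then show ?thesis
      using s self_in_chamber convex_chamber face_of_refl unfolding relu_fan_def by blast
  qed
  have maximal: "\<kappa> = \<sigma>"
    if s: "\<sigma> \<in> closed_chambers n A" and k: "\<kappa> \<in> relu_fan n A" and sub: "\<sigma> \<subseteq> \<kappa>" for \<sigma> \<kappa>
  proof -
    obtain x where x: "regular_point n A x" "\<sigma> = chamber n A x"
      using s by (auto simp: closed_chambers_eq)
    obtain y where y: "regular_point n A y" "\<kappa> face_of chamber n A y"
      using k by (auto simp: closed_chambers_eq relu_fan_def)
    have "\<kappa> \<subseteq> chamber n A y" using y(2) face_of_imp_subset by blast
    then have "x \<in> chamber n A y" using x sub self_in_chamber by blast
    then have "0 < (A k \<bullet> y) * (A k \<bullet> x)" if "k < n" for k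
      using x(1) y(1) that by (auto simp: chamber_def regular_point_def less_le)
    then have "chamber n A y = chamber n A x" by (rule chamber_cong)
    then show ?thesis using \<open>\<kappa> \<subseteq> chamber n A y\<close> x(2) sub by blast
  qed
  show ?thesis
  proof
    show "closed_chambers n A \<subseteq> maximal_cones (relu_fan n A)"
      using fan maximal by (auto simp: maximal_cones_def)
    show "maximal_cones (relu_fan n A) \<subseteq> closed_chambers n A"
    proof
      fix \<sigma> assume s: "\<sigma> \<in> maximal_cones (relu_fan n A)"
      then obtain C where C: "C \<in> closed_chambers n A" "\<sigma> face_of C"
        by (auto simp: maximal_cones_def relu_fan_def)
      then have "C = \<sigma>"
        using s fan[OF C(1)] face_of_imp_subset unfolding maximal_cones_def by blast
      with C show "\<sigma> \<in> closed_chambers n A" by simp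
    qed
  qed
qed

text \<open>On the chamber no row changes sign, so each neuron is either linear throughout or zero
  throughout.\<close>

lemma relu_rep_on_chamber:
  assumes f: "rational_relu_rep n A b f" and x: "regular_point n A x" and w: "w \<in> chamber n A x"
  shows "f w = relu_gradient n A b x \<bullet> w"
proof -
  have "f w = (\<Sum>k<n. b k * max 0 (A k \<bullet> w))"
    using f by (simp add: rational_relu_rep_def output_map_def relu_def input_map_def)
  also have "\<dots> = (\<Sum>k<n. (if 0 < A k \<bullet> x then b k *\<^sub>R A k else 0) \<bullet> w)"
  proof (rule sum.cong)
    fix k assume "k \<in> {..<n}"
    then have "0 \<le> (A k \<bullet> x) * (A k \<bullet> w)" "A k \<bullet> x \<noteq> 0"
      using x w by (auto simp: chamber_def regular_point_def)
    then show "b k * max 0 (A k \<bullet> w) = (if 0 < A k \<bullet> x then b k *\<^sub>R A k else 0) \<bullet> w"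
      by (auto simp: zero_le_mult_iff)
  qed simp
  finally show ?thesis by (simp add: relu_gradient_def inner_sum_left)
qed

text \<open>This gives uniqueness of the Cartier data. For large \<open>M\<close> the point
  \<open>M x + (p - q)\<close> still lies in the chamber; since \<open>p - q\<close> vanishes on it
  and on \<open>x\<close>, it is orthogonal to itself.\<close>

lemma chamber_separates_functionals:
  assumes x: "regular_point n A x" and eq: "\<And>w. w \<in> chamber n A x \<Longrightarrow> p \<bullet> w = q \<bullet> w"
  shows "p = q"
proof -
  have "0 < (A k \<bullet> x) * (A k \<bullet> x)" if "k \<in> {..<n}" for k
    using regular_point_square_pos[OF x] that by simp
  then obtain M :: nat
    where M: "\<And>k. k \<in> {..<n} \<Longrightarrow>
      0 < real M * ((A k \<bullet> x) * (A k \<bullet> x)) + (A k \<bullet> x) * (A k \<bullet> (p - q))"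
    using large_multiple_dominates[of "{..<n}" "\<lambda>k. (A k \<bullet> x) * (A k \<bullet> x)"
        "\<lambda>k. (A k \<bullet> x) * (A k \<bullet> (p - q))"] by auto
  have "0 \<le> (A k \<bullet> x) * (A k \<bullet> (real M *\<^sub>R x + (p - q)))" if "k < n" for k
    using M[of k] that unfolding inner_add_right inner_scaleR_right distrib_left
    by (simp add: mult.left_commute less_imp_le)
  then have "real M *\<^sub>R x + (p - q) \<in> chamber n A x"
    by (simp add: chamber_def)
  then have "(p - q) \<bullet> (real M *\<^sub>R x + (p - q)) = 0"
    using eq by (simp only: inner_diff_left)
  moreover have "(p - q) \<bullet> x = 0" using eq[OF self_in_chamber] by (simp add: inner_diff_left)
  ultimately have "(p - q) \<bullet> (p - q) = 0" by (simp add: inner_add_right)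
  then show ?thesis by simp
qed

lemma support_divisor_chamber:
  assumes f: "rational_relu_rep n A b f" and x: "regular_point n A x"
  shows "support_divisor (relu_fan n A) f (chamber n A x) = relu_gradient n A b x"
proof -
  have "(THE m. (\<forall>j. m $ j \<in> \<rat>) \<and> (\<forall>u\<in>chamber n A x. f u = m \<bullet> u)) = relu_gradient n A b x"
  proof (rule the_equality)
    have "relu_gradient n A b x $ j \<in> \<rat>" for j
      unfolding relu_gradient_def sum_component
      using f by (intro Rats_sum) (auto simp: rational_relu_rep_def)
    then show "(\<forall>j. relu_gradient n A b x $ j \<in> \<rat>) \<and>
        (\<forall>u\<in>chamber n A x. f u = relu_gradient n A b x \<bullet> u)"
      using relu_rep_on_chamber[OF f x] by blast
  qed (use relu_rep_on_chamber[OF f x] chamber_separates_functionals[OF x] in metis)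
  moreover have "chamber n A x \<in> maximal_cones (relu_fan n A)"
    using x by (auto simp: maximal_cones_relu_fan closed_chambers_eq)
  ultimately show ?thesis by (simp add: support_divisor_def)
qed

section \<open>Primitive rows and the jump of the gradient across a wall\<close>

text \<open>The gcd condition enters as the existence of a lattice point of height 1 over each
  hyperplane.\<close>

locale primitive_arrangement =
  fixes n :: nat and A :: "nat \<Rightarrow> real ^ 'n"
  assumes row_lattice: "k < n \<Longrightarrow> A k \<in> lattice"
    and row_unimodular: "k < n \<Longrightarrow> \<exists>v\<in>lattice. A k \<bullet> v = 1"
begin

text \<open>These are the rows that define the hyperplane of \<open>A i\<close>. In a reduced
  representation there are at most two: \<open>A i\<close> and possibly its negative.\<close>

abbreviation parallel_rows :: "nat \<Rightarrow> nat set" where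
  "parallel_rows i \<equiv> {k. k < n \<and> (A k = A i \<or> A k = - A i)}"

lemma row_nonzero: "k < n \<Longrightarrow> A k \<noteq> 0"
  using row_unimodular by fastforce

lemma nonparallel_not_vanishing:
  assumes "i < n" "k < n" "k \<notin> parallel_rows i"
  obtains x where "x \<in> hyperplane (A i)" "A k \<bullet> x \<noteq> 0"
proof -
  obtain v where v: "v \<in> lattice" "A i \<bullet> v = 1" using row_unimodular assms(1) by blast
  obtain w where w: "w \<in> lattice" "A k \<bullet> w = 1" using row_unimodular assms(2) by blast
  have "\<not> (\<forall>x. A i \<bullet> x = 0 \<longrightarrow> A k \<bullet> x = 0)"
    using unimodular_functionals_same_kernel[OF row_lattice[OF assms(1)] v row_lattice[OF assms(2)] w]
      assms by blast
  then show thesis using that by (auto simp: hyperplane_def)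
qed

text \<open>A row that vanishes on \<open>\<tau>\<close> vanishes on its span, the whole hyperplane
  of \<open>A i\<close>, and is then \<open>A i\<close> or \<open>- A i\<close> by
  primitivity.\<close>

lemma nonparallel_not_vanishing_on_spanning:
  assumes "i < n" "k < n" "k \<notin> parallel_rows i" and span: "span \<tau> = hyperplane (A i)"
  obtains x where "x \<in> \<tau>" "A k \<bullet> x \<noteq> 0"
proof -
  have "\<not> \<tau> \<subseteq> hyperplane (A k)"
  proof
    assume "\<tau> \<subseteq> hyperplane (A k)"
    then have "hyperplane (A i) \<subseteq> hyperplane (A k)"
      using span_minimal[OF _ subspace_hyperplane] span by (metis hyperplane_def)
    then show False
      using nonparallel_not_vanishing[OF assms(1-3)] by (auto simp: hyperplane_def)
  qed
  then show thesis using that by (auto simp: hyperplane_def)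
qed

text \<open>A nonparallel row is nonzero at some point of \<open>\<tau>\<close>, which lies in both
  chambers, so its signs at \<open>x\<close> and \<open>y\<close> agree and its contributions
  cancel. The parallel rows change sign together, and they must do so because the chambers
  differ.\<close>

lemma gradient_jump_across_wall:
  assumes i: "i < n" and span: "span \<tau> = hyperplane (A i)"
    and x: "regular_point n A x" and y: "regular_point n A y"
    and ne: "chamber n A x \<noteq> chamber n A y" and wall: "\<tau> = chamber n A x \<inter> chamber n A y"
  shows "relu_gradient n A b x - relu_gradient n A b y
       = - (sgn (A i \<bullet> y) * (\<Sum>k\<in>parallel_rows i. b k)) *\<^sub>R A i"
proof -
  have same: "0 < (A k \<bullet> x) * (A k \<bullet> y)" if k: "k < n" "k \<notin> parallel_rows i" for k
  proof (rule ccontr)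
    assume "\<not> 0 < (A k \<bullet> x) * (A k \<bullet> y)"
    then have opp: "0 < A k \<bullet> x \<and> A k \<bullet> y < 0 \<or> A k \<bullet> x < 0 \<and> 0 < A k \<bullet> y"
      using x y k(1) unfolding regular_point_def by (metis linorder_neqE_linordered_idom mult_neg_neg mult_pos_pos)
    obtain w where w: "w \<in> \<tau>" "A k \<bullet> w \<noteq> 0"
      using nonparallel_not_vanishing_on_spanning[OF i k span] .
    then have "0 \<le> (A k \<bullet> x) * (A k \<bullet> w)" "0 \<le> (A k \<bullet> y) * (A k \<bullet> w)"
      using k(1) by (auto simp: wall chamber_def)
    with opp w(2) show False by (smt (verit) zero_le_mult_iff)
  qed
  have par: "(A k \<bullet> x) * (A k \<bullet> y) = (A i \<bullet> x) * (A i \<bullet> y)" if "k \<in> parallel_rows i" for k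
    using that by auto
  have opp: "(A i \<bullet> x) * (A i \<bullet> y) < 0"
  proof (rule ccontr)
    assume "\<not> (A i \<bullet> x) * (A i \<bullet> y) < 0"
    then have "0 < (A i \<bullet> x) * (A i \<bullet> y)"
      using x y i unfolding regular_point_def by (metis linorder_neqE_linordered_idom mult_eq_0_iff)
    then have "0 < (A k \<bullet> x) * (A k \<bullet> y)" if "k < n" for k
      using same par that by (cases "k \<in> parallel_rows i") auto
    then show False using ne chamber_cong by blast
  qed
  have "relu_gradient n A b x - relu_gradient n A b y
      = (\<Sum>k<n. (if 0 < A k \<bullet> x then b k *\<^sub>R A k else 0) - (if 0 < A k \<bullet> y then b k *\<^sub>R A k else 0))"
    by (simp add: relu_gradient_def sum_subtractf)
  also have "\<dots> = (\<Sum>k\<in>parallel_rows i. - (sgn (A i \<bullet> y) * b k) *\<^sub>R A i)"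
  proof (rule sum.mono_neutral_cong_right)
    show "\<forall>k\<in>{..<n} - parallel_rows i.
        (if 0 < A k \<bullet> x then b k *\<^sub>R A k else 0) - (if 0 < A k \<bullet> y then b k *\<^sub>R A k else 0) = 0"
      using same by (auto simp: zero_less_mult_iff dest!: same)
    \<comment> \<open>For \<open>A k = - A i\<close> both the row and its active side are reversed,
      so the two signs cancel and both orientations contribute alike.\<close>
    show "(if 0 < A k \<bullet> x then b k *\<^sub>R A k else 0) - (if 0 < A k \<bullet> y then b k *\<^sub>R A k else 0)
        = - (sgn (A i \<bullet> y) * b k) *\<^sub>R A i" if "k \<in> parallel_rows i" for k
      using that opp by (auto simp: mult_less_0_iff)
  qed auto
  finally show ?thesis
    by (simp add: sum_negf sum_distrib_left flip: scaleR_left.sum)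
qed

text \<open>Minimality is tested on a lattice point of height \<open>\<plusminus> 1\<close> on the
  side of \<open>y\<close>; this height is a multiple of the integer
  \<open>A i \<bullet> u\<close>.\<close>

lemma minimal_generator_unit_height:
  assumes i: "i < n" and span: "span \<tau> = hyperplane (A i)"
    and y: "regular_point n A y" and u: "lifts_minimal_generator \<tau> (chamber n A y) u"
  shows "sgn (A i \<bullet> y) * (A i \<bullet> u) = 1"
proof -
  let ?s = "sgn (A i \<bullet> y)"
  have nz: "A i \<bullet> y \<noteq> 0" using y i by (simp add: regular_point_def)
  have uC: "u \<in> chamber n A y" and uL: "u \<in> lattice"
    and min: "\<And>v. v \<in> lattice \<Longrightarrow> \<exists>s\<in>chamber n A y. \<exists>t\<in>span \<tau>. v = s + t \<Longrightarrow>
        \<exists>k::nat. v - of_nat k *\<^sub>R u \<in> wall_lattice \<tau>"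
    using u unfolding lifts_minimal_generator_def by blast+
  obtain v0 where v0: "v0 \<in> lattice" "A i \<bullet> v0 = 1" using row_unimodular i by blast
  define v where "v = ?s *\<^sub>R v0"
  \<comment> \<open>\<open>y\<close> is rescaled to the height of \<open>v\<close>, so
    \<open>v - s\<close> lies in the span of \<open>\<tau>\<close> and the class of \<open>v\<close>
    lies on the image ray.\<close>
  define s where "s = inverse \<bar>A i \<bullet> y\<bar> *\<^sub>R y"
  have "A i \<bullet> v = ?s" using v0 by (simp add: v_def)
  moreover have "A i \<bullet> s = ?s" using nz by (auto simp: s_def sgn_if)
  ultimately have "v - s \<in> span \<tau>" by (simp add: span hyperplane_def inner_diff_right)
  moreover have "s \<in> chamber n A y"
    unfolding s_def by (rule chamber_scaleR[OF self_in_chamber]) simp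
  moreover have "v \<in> lattice" unfolding v_def using v0 by (intro lattice_scaleR) (auto simp: sgn_if)
  ultimately obtain k :: nat where "v - of_nat k *\<^sub>R u \<in> wall_lattice \<tau>"
    using min[of v] by (metis add.commute diff_add_cancel)
  then have "A i \<bullet> v = real k * (A i \<bullet> u)"
    by (simp add: wall_lattice_def span hyperplane_def inner_diff_right)
  then have s: "?s = real k * (A i \<bullet> u)" using \<open>A i \<bullet> v = ?s\<close> by simp
  obtain m where m: "A i \<bullet> u = of_int m"
    using lattice_inner[OF row_lattice[OF i] uL] by (rule Ints_cases)
  have "?s * ?s = 1" using nz by (simp add: sgn_if)
  then have "real k * (?s * of_int m) = 1" using s m by (metis mult.left_commute)
  moreover obtain e :: int where e: "?s = of_int e" 
    by (metis Ints_cases Ints_0 Ints_1 Ints_minus sgn_if)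
  ultimately have "of_int (int k * (e * m)) = (1::real)" by simp
  then have "int k * (e * m) = 1" by linarith
  \<comment> \<open>Since \<open>int k\<close> is nonnegative, the factorisation of 1 into two
    factors -1 is excluded.\<close>
  then have "e * m = 1" by (auto simp: zmult_eq_1_iff[of "int k"])
  then show ?thesis using e m by (metis of_int_1 of_int_mult)
qed

section \<open>Walls and lattice points near them\<close>

text \<open>By dimension \<open>\<tau>\<close> spans the hyperplane. It is a face of the full
  intersection, and a proper face would have smaller dimension.\<close>

lemma wall_eq_chamber_Int_hyperplane:
  assumes i: "i < n" and \<tau>: "\<tau> \<in> walls (relu_fan n A)" "\<tau> \<subseteq> hyperplane (A i)"
  obtains x where "regular_point n A x" "\<tau> = chamber n A x \<inter> hyperplane (A i)"
    "span \<tau> = hyperplane (A i)"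
proof -
  obtain x where x: "regular_point n A x" and face: "\<tau> face_of chamber n A x"
    and ne: "\<tau> \<noteq> {}" and dim: "dim \<tau> + 1 = CARD('n)"
    using \<tau>(1) by (auto simp: walls_def relu_fan_def closed_chambers_eq)
  have sub: "subspace (hyperplane (A i))"
    unfolding hyperplane_def by (rule subspace_hyperplane)
  have dimH: "dim (hyperplane (A i)) = CARD('n) - 1"
    using dim_hyperplane[OF row_nonzero[OF i]] by (simp add: hyperplane_def)
  \<comment> \<open>Faces are compared by \<open>aff_dim\<close>, walls are defined by
    \<open>dim\<close>; the two agree on \<open>\<tau>\<close> once it contains the origin.\<close>
  have "0 \<in> \<tau>"
  proof -
    obtain w where w: "w \<in> \<tau>" using ne by blast
    show ?thesis
    proof (cases "w = 0")
      case False
      have "w \<in> chamber n A x" using w face face_of_imp_subset by blast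
      then have "0 \<in> chamber n A x" "2 *\<^sub>R w \<in> chamber n A x"
        using chamber_scaleR[of w n A x 0] chamber_scaleR[of w n A x 2] by auto
      \<comment> \<open>\<open>w\<close> is the midpoint of two points of the chamber, so a face
        through \<open>w\<close> contains both.\<close>
      moreover have "w \<in> open_segment 0 (2 *\<^sub>R w)"
        unfolding in_segment using False by (intro conjI exI[of _ "1/2"]) auto
      ultimately show ?thesis using face w unfolding face_of_def by blast
    qed (use w in simp)
  qed
  have sp: "span \<tau> = hyperplane (A i)"
    using dim_eq_span[OF \<tau>(2)] dim dimH sub by (simp add: span_eq_iff[THEN iffD2])
  let ?F = "chamber n A x \<inter> hyperplane (A i)"
  have "\<tau> = ?F"
  proof (rule ccontr)
    assume "\<tau> \<noteq> ?F"
    moreover have "\<tau> face_of ?F"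
      using face \<tau>(2) by (intro face_of_subset[OF face]) (auto dest: face_of_imp_subset)
    moreover have "convex ?F"
      by (intro convex_Int convex_chamber subspace_imp_convex sub)
    ultimately have "aff_dim \<tau> < aff_dim ?F" by (intro face_of_aff_dim_lt)
    also have "\<dots> \<le> aff_dim (hyperplane (A i))" by (intro aff_dim_subset) simp
    also have "\<dots> = int (dim \<tau>)" using sub dimH dim by (simp add: aff_dim_subspace)
    also have "\<dots> = aff_dim \<tau>" using \<open>0 \<in> \<tau>\<close> by (simp add: aff_dim_zero hull_inc)
    finally show False by simp
  qed
  then show thesis using that x sp by blast
qed

text \<open>
  The dyadic points are dense in the space, hence so are their images under the rational projection
  \<open>w \<mapsto> w - (A i \<bullet> w) v\<close> in the hyperplane.
\<close>

lemma lattice_point_in_relative_interior_of_wall: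
  assumes i: "i < n" and x: "regular_point n A x"
    and span: "span (chamber n A x \<inter> hyperplane (A i)) = hyperplane (A i)"
  obtains p where "p \<in> lattice" "A i \<bullet> p = 0"
    "\<And>k. k < n \<Longrightarrow> k \<notin> parallel_rows i \<Longrightarrow> 0 < (A k \<bullet> x) * (A k \<bullet> p)"
proof -
  let ?\<tau> = "chamber n A x \<inter> hyperplane (A i)" and ?K = "{..<n} - parallel_rows i"
  have "\<exists>z\<in>?\<tau>. 0 < (A k \<bullet> x) * (A k \<bullet> z)" if k: "k \<in> ?K" for k
  proof -
    from k have "k < n" "k \<notin> parallel_rows i" by auto
    then obtain z where "z \<in> ?\<tau>" "A k \<bullet> z \<noteq> 0"
      by (rule nonparallel_not_vanishing_on_spanning[OF i _ _ span])
    then show ?thesis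
      using x \<open>k < n\<close> by (intro bexI[of _ z]) (auto simp: chamber_def regular_point_def less_le)
  qed
  then have "\<forall>k\<in>?K. \<exists>z. z \<in> ?\<tau> \<and> 0 < (A k \<bullet> x) * (A k \<bullet> z)" by blast
  then obtain z where z: "\<And>k. k \<in> ?K \<Longrightarrow> z k \<in> ?\<tau> \<and> 0 < (A k \<bullet> x) * (A k \<bullet> z k)"
    by (rule bchoice[THEN exE]) blast
  \<comment> \<open>In the sum every term has weakly the right sign for row \<open>k\<close>, and
    \<open>z k\<close> has it strictly, so \<open>z0\<close> satisfies all strict conditions at
    once.\<close>
  define z0 where "z0 = (\<Sum>k\<in>?K. z k)"
  have z0: "0 < (A k \<bullet> x) * (A k \<bullet> z0)" if k: "k \<in> ?K" for k
  proof -
    have "0 < (\<Sum>l\<in>?K. (A k \<bullet> x) * (A k \<bullet> z l))"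
      using z k by (intro sum_pos2[of _ k]) (auto simp: chamber_def)
    then show ?thesis by (simp add: z0_def inner_sum_right sum_distrib_left)
  qed
  have z0H: "A i \<bullet> z0 = 0" using z by (simp add: z0_def inner_sum_right hyperplane_def)
  obtain v where v: "v \<in> lattice" "A i \<bullet> v = 1" using row_unimodular i by blast
  define \<pi> where "\<pi> w = w - (A i \<bullet> w) *\<^sub>R v" for w
  \<comment> \<open>Pulling the sign conditions back along \<open>\<pi>\<close> gives an open set of
    the whole space, where density of dyadic points applies.\<close>
  let ?S = "\<Inter>k\<in>?K. {w. 0 < (A k \<bullet> x) * (A k \<bullet> \<pi> w)}"
  have "open ?S"
    unfolding \<pi>_def by (intro open_INT ballI open_Collect_less continuous_intros) auto
  moreover have "z0 \<in> ?S" using z0 z0H by (simp add: \<pi>_def)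
  ultimately obtain w c where w: "w \<in> ?S" "0 < c" "c *\<^sub>R w \<in> lattice"
    using open_contains_scaled_lattice_point[of ?S] by blast
  show thesis
  proof (rule that[of "\<pi> (c *\<^sub>R w)"])
    show "\<pi> (c *\<^sub>R w) \<in> lattice"
      unfolding \<pi>_def
      by (rule lattice_diff[OF w(3) lattice_scaleR[OF lattice_inner[OF row_lattice[OF i] w(3)] v(1)]])
    show "A i \<bullet> \<pi> (c *\<^sub>R w) = 0" using v by (simp add: \<pi>_def inner_diff_right)
    have "\<pi> (c *\<^sub>R w) = c *\<^sub>R \<pi> w" by (simp add: \<pi>_def scaleR_right_diff_distrib)
    then show "0 < (A k \<bullet> x) * (A k \<bullet> \<pi> (c *\<^sub>R w))" if "k < n" "k \<notin> parallel_rows i" for k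
      using w(1,2) that by (simp add: mult.left_commute)
  qed
qed

text \<open>A large multiple of a lattice point inside the wall is shifted by a lattice vector of
  height 1 towards the other side. The shift fixes the height, and the multiple preserves the signs
  of all nonparallel rows.\<close>

lemma lattice_point_beyond_wall:
  assumes i: "i < n" and x: "regular_point n A x"
    and span: "span (chamber n A x \<inter> hyperplane (A i)) = hyperplane (A i)"
  obtains u where "u \<in> lattice" "A i \<bullet> u = - sgn (A i \<bullet> x)"
    "\<forall>k<n. k \<notin> parallel_rows i \<longrightarrow> 0 < (A k \<bullet> x) * (A k \<bullet> u)"
proof -
  let ?K = "{..<n} - parallel_rows i"
  obtain p where p: "p \<in> lattice" "A i \<bullet> p = 0"
    "\<And>k. k < n \<Longrightarrow> k \<notin> parallel_rows i \<Longrightarrow> 0 < (A k \<bullet> x) * (A k \<bullet> p)"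
    using lattice_point_in_relative_interior_of_wall[OF assms] by blast
  obtain v where v: "v \<in> lattice" "A i \<bullet> v = 1" using row_unimodular i by blast
  define v' where "v' = - sgn (A i \<bullet> x) *\<^sub>R v"
  obtain M :: nat
    where M: "\<And>k. k \<in> ?K \<Longrightarrow> 0 < real M * ((A k \<bullet> x) * (A k \<bullet> p)) + (A k \<bullet> x) * (A k \<bullet> v')"
    using large_multiple_dominates[of ?K "\<lambda>k. (A k \<bullet> x) * (A k \<bullet> p)"
        "\<lambda>k. (A k \<bullet> x) * (A k \<bullet> v')"] p(3) by auto
  show thesis
  proof (rule that[of "real M *\<^sub>R p + v'"])
    show "real M *\<^sub>R p + v' \<in> lattice"
      unfolding v'_def using p(1) v(1) by (intro lattice_add lattice_scaleR) (auto simp: sgn_if)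
    show "A i \<bullet> (real M *\<^sub>R p + v') = - sgn (A i \<bullet> x)"
      using p(2) v(2) by (simp add: v'_def inner_add_right inner_diff_right)
    have "0 < (A k \<bullet> x) * (A k \<bullet> (real M *\<^sub>R p + v'))" if "k < n" "k \<notin> parallel_rows i" for k
      using M[of k] that unfolding inner_add_right inner_scaleR_right distrib_left
      by (simp add: mult.left_commute)
    then show "\<forall>k<n. k \<notin> parallel_rows i \<longrightarrow> 0 < (A k \<bullet> x) * (A k \<bullet> (real M *\<^sub>R p + v'))"
      by blast
  qed
qed

lemma unit_height_lifts_minimal_generator:
  assumes i: "i < n" and span: "span \<tau> = hyperplane (A i)"
    and u: "u \<in> lattice" "\<bar>A i \<bullet> u\<bar> = 1"
  shows "lifts_minimal_generator \<tau> (chamber n A u) u"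
  unfolding lifts_minimal_generator_def
proof (intro conjI ballI impI)
  show "u \<in> chamber n A u \<inter> lattice" using u(1) self_in_chamber by blast
  fix v assume v: "v \<in> lattice" "\<exists>s\<in>chamber n A u. \<exists>t\<in>span \<tau>. v = s + t"
  then obtain s t where st: "s \<in> chamber n A u" "A i \<bullet> t = 0" "v = s + t"
    by (auto simp: span hyperplane_def)
  then have nonneg: "0 \<le> (A i \<bullet> u) * (A i \<bullet> v)"
    using i by (simp add: chamber_def inner_add_right)
  obtain m where m: "A i \<bullet> v = of_int m"
    using lattice_inner[OF row_lattice[OF i] v(1)] by (rule Ints_cases)
  \<comment> \<open>The multiplier is the absolute height of \<open>v\<close>: \<open>u\<close> has
    height \<open>\<plusminus> 1\<close>, and \<open>v\<close> lies weakly on the same side.\<close>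
  have "real (nat \<bar>m\<bar>) = \<bar>A i \<bullet> v\<bar>" using m by simp
  moreover have "A i \<bullet> v = \<bar>A i \<bullet> v\<bar> * (A i \<bullet> u)"
    using nonneg u(2) by (auto simp: abs_if split: if_splits)
  ultimately have "A i \<bullet> (v - of_nat (nat \<bar>m\<bar>) *\<^sub>R u) = 0"
    by (simp add: inner_diff_right)
  moreover have "v - of_nat (nat \<bar>m\<bar>) *\<^sub>R u \<in> lattice"
    using v(1) u(1) by (intro lattice_diff lattice_scaleR) auto
  ultimately show "\<exists>k::nat. v - of_nat k *\<^sub>R u \<in> wall_lattice \<tau>"
    unfolding wall_lattice_def span hyperplane_def by blast
qed

section \<open>The intersection number of a wall\<close>

text \<open>The description under \<open>THE\<close> must be realised and must force the value. The
  fact \<open>jump\<close> covers every admissible choice, in either order of the cones; the rest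
  constructs one choice.\<close>

lemma intersection_number_wall:
  assumes f: "rational_relu_rep n A b f" and i: "i < n"
    and \<tau>: "\<tau> \<in> walls (relu_fan n A)" "\<tau> \<subseteq> hyperplane (A i)"
  shows "intersection_number (relu_fan n A) (support_divisor (relu_fan n A) f) \<tau>
       = - (\<Sum>k\<in>parallel_rows i. b k)"
proof -
  let ?D = "support_divisor (relu_fan n A) f"
  obtain x where x: "regular_point n A x" and \<tau>_eq: "\<tau> = chamber n A x \<inter> hyperplane (A i)"
    and span: "span \<tau> = hyperplane (A i)"
    using wall_eq_chamber_Int_hyperplane[OF i \<tau>] .
  have jump: "(?D \<sigma> - ?D \<sigma>') \<bullet> u = - (\<Sum>k\<in>parallel_rows i. b k)"
    if max: "\<sigma> \<in> maximal_cones (relu_fan n A)" "\<sigma>' \<in> maximal_cones (relu_fan n A)"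
      and meet: "\<sigma> \<noteq> \<sigma>'" "\<tau> = \<sigma> \<inter> \<sigma>'" and lift: "lifts_minimal_generator \<tau> \<sigma>' u" for \<sigma> \<sigma>' u
  proof -
    obtain y where y: "regular_point n A y" "\<sigma> = chamber n A y"
      using max(1) unfolding maximal_cones_relu_fan closed_chambers_eq by blast
    obtain z where z: "regular_point n A z" "\<sigma>' = chamber n A z"
      using max(2) unfolding maximal_cones_relu_fan closed_chambers_eq by blast
    have "?D \<sigma> - ?D \<sigma>' = - (sgn (A i \<bullet> z) * (\<Sum>k\<in>parallel_rows i. b k)) *\<^sub>R A i"
      using gradient_jump_across_wall[OF i span y(1) z(1)] meet y z
      by (simp add: support_divisor_chamber[OF f])
    then have "(?D \<sigma> - ?D \<sigma>') \<bullet> u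
        = - (sgn (A i \<bullet> z) * (A i \<bullet> u)) * (\<Sum>k\<in>parallel_rows i. b k)"
      by simp
    then show ?thesis
      \<comment> \<open>The sign in the gradient jump and the sign of the height of \<open>u\<close>
        multiply to 1, so the side no longer matters.\<close>
      using minimal_generator_unit_height[OF i span z(1)] lift z(2) by simp
  qed
  \<comment> \<open>This one point serves as the base point of the chamber across the wall and as
    the lift of its minimal generator.\<close>
  obtain u where u: "u \<in> lattice" "A i \<bullet> u = - sgn (A i \<bullet> x)"
    "\<forall>k<n. k \<notin> parallel_rows i \<longrightarrow> 0 < (A k \<bullet> x) * (A k \<bullet> u)"
    using lattice_point_beyond_wall[OF i x span[unfolded \<tau>_eq]] .
  have nz: "A i \<bullet> x \<noteq> 0" using x i by (simp add: regular_point_def)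
  then have opp: "(A k \<bullet> x) * (A k \<bullet> u) < 0" if "k \<in> parallel_rows i" for k
    using that u(2) by (auto simp: sgn_if)
  have reg: "regular_point n A u"
    unfolding regular_point_def using u(3) opp by fastforce
  have ne: "chamber n A x \<noteq> chamber n A u"
  proof
    assume "chamber n A x = chamber n A u"
    then have "u \<in> chamber n A x" using self_in_chamber by blast
    then show False using opp[of i] i by (auto simp: chamber_def)
  qed
  have meet: "\<tau> = chamber n A x \<inter> chamber n A u"
  proof -
    \<comment> \<open>The chambers of \<open>x\<close> and \<open>u\<close> impose opposite signs on
      row \<open>i\<close>, so a common point has height 0; the nonparallel rows impose the same
      condition in both.\<close>
    have "w \<in> chamber n A u \<longleftrightarrow> w \<in> hyperplane (A i)" if w: "w \<in> chamber n A x" for w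
    proof
      assume "w \<in> chamber n A u"
      then have "0 \<le> (A i \<bullet> u) * (A i \<bullet> w)" "0 \<le> (A i \<bullet> x) * (A i \<bullet> w)"
        using w i by (auto simp: chamber_def)
      with opp[of i] i show "w \<in> hyperplane (A i)"
        unfolding hyperplane_def by (smt (verit) mem_Collect_eq mult_less_0_iff zero_le_mult_iff)
    next
      assume wH: "w \<in> hyperplane (A i)"
      have "0 \<le> (A k \<bullet> u) * (A k \<bullet> w)" if k: "k < n" for k
      proof (cases "k \<in> parallel_rows i")
        case True
        then show ?thesis using wH by (auto simp: hyperplane_def)
      next
        case False
        have "0 \<le> (A k \<bullet> x) * (A k \<bullet> w)" using w k by (simp add: chamber_def)
        moreover from u(3) k False have "0 < (A k \<bullet> x) * (A k \<bullet> u)" by blast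
        ultimately show ?thesis by (smt (verit) zero_less_mult_iff zero_le_mult_iff)
      qed
      then show "w \<in> chamber n A u" by (simp add: chamber_def)
    qed
    then show ?thesis unfolding \<tau>_eq by blast
  qed
  have lift: "lifts_minimal_generator \<tau> (chamber n A u) u"
    using unit_height_lifts_minimal_generator[OF i span u(1)] u(2) nz by (simp add: sgn_if)
  have max: "chamber n A x \<in> maximal_cones (relu_fan n A)"
    "chamber n A u \<in> maximal_cones (relu_fan n A)"
    using x reg unfolding maximal_cones_relu_fan closed_chambers_eq by blast+
  show ?thesis
    unfolding intersection_number_def
  proof (rule the_equality, goal_cases)
    case 1
    show ?case
      by (rule exI[of _ "chamber n A x"], rule exI[of _ "chamber n A u"], rule exI[of _ u])
        (intro conjI max ne meet lift jump[OF max ne meet lift, symmetric])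
  next
    case (2 q)
    then obtain \<sigma> \<sigma>' u where "\<sigma> \<in> maximal_cones (relu_fan n A)" "\<sigma>' \<in> maximal_cones (relu_fan n A)"
      "\<sigma> \<noteq> \<sigma>'" "\<tau> = \<sigma> \<inter> \<sigma>'" "lifts_minimal_generator \<tau> \<sigma>' u" and q: "q = (?D \<sigma> - ?D \<sigma>') \<bullet> u"
      by (elim exE conjE)
    then show ?case unfolding q by (intro jump)
  qed
qed

end

lemma reduced_relu_rep_primitive:
  "reduced_relu_rep n A b f \<Longrightarrow> primitive_arrangement n A"
proof unfold_locales
  assume red: "reduced_relu_rep n A b f"
  fix k assume k: "k < n"
  show L: "A k \<in> lattice" using red k by (simp add: reduced_relu_rep_def lattice_def)
  have "Gcd (range (\<lambda>j. \<lfloor>A k $ j\<rfloor>)) = 1" using red k by (simp add: reduced_relu_rep_def)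
  then show "\<exists>v\<in>lattice. A k \<bullet> v = 1"
    using lattice_unimodular_functional[OF L] by metis
qed

theorem theorem3:
  fixes f :: "real ^ 'n \<Rightarrow> real"
    and n\<^sub>1 :: nat and A :: "nat \<Rightarrow> real ^ 'n" and b :: "nat \<Rightarrow> real"
  assumes "f \<in> ReLU_Q"
    and "reduced_relu_rep n\<^sub>1 A b f"
    and "\<forall>\<sigma> \<in> relu_fan n\<^sub>1 A. strongly_convex \<sigma>"
    and "i < n\<^sub>1"
    and "\<tau>\<^sub>1 \<in> walls (relu_fan n\<^sub>1 A)" and "\<tau>\<^sub>1 \<subseteq> hyperplane (A i)"
    and "\<tau>\<^sub>2 \<in> walls (relu_fan n\<^sub>1 A)" and "\<tau>\<^sub>2 \<subseteq> hyperplane (A i)"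
  shows "intersection_number (relu_fan n\<^sub>1 A) (support_divisor (relu_fan n\<^sub>1 A) f) \<tau>\<^sub>1 =
         intersection_number (relu_fan n\<^sub>1 A) (support_divisor (relu_fan n\<^sub>1 A) f) \<tau>\<^sub>2"
proof -
  interpret primitive_arrangement n\<^sub>1 A
    using assms(2) by (rule reduced_relu_rep_primitive)
  have "rational_relu_rep n\<^sub>1 A b f" using assms(2) by (simp add: reduced_relu_rep_def)
  \<comment> \<open>Both numbers equal a value that depends on \<open>i\<close> but not on the
    wall.\<close>
  then show ?thesis using intersection_number_wall assms(4-8) by simp
qed

end
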